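(* Let $\delta t>0$, $\delta x>0$. For every sequence $\rho_i\in[0,R)$, $i\in\mathbb{Z}$, with $\sum_{i\in\mathbb{Z}}\rho_i<+\infty$, the sequence $(\rho_i^+)_{i\in\mathbb{Z}}$ defined by $$\rho_i^+=\rho_i+\frac{\delta t}{\delta x}(G_{i-1}-G_i),\qquad G_i=\rho_i h(-q_i),\qquad q_i=\frac{Q'(\rho_{i+1})-Q'(\rho_i)}{\delta x},\qquad i\in\mathbb{Z},$$ satisfies $\sum_{i\in\mathbb{Z}}\rho_i^+=\sum_{i\in\mathbb{Z}}\rho_i$.
   Context: Constants: $R>1$, $b>0$. The function $\kappa\in C^1([0,R);[0,+\infty))$ satisfies $\kappa(\rho)=0$ for $\rho\in[0,1]$ and $\kappa(\rho)>0$ for $\rho\in(1,R)$. The function $h\in C^1(\mathbb{R};(-1,b))$ satisfies $h'\in L^\infty(\mathbb{R})$, $h(0)=0$, $h'(s)>0$ for all $s\in\mathbb{R}$, and is onto $(-1,b)$. Define $Q(\rho)=\int_1^\rho(\rho-\tau)\kappa(\tau)\,d\tau$ for $\rho\in[0,R)$, so $Q'(\rho)=\int_1^\rho\kappa(\tau)\,d\tau$. *)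

theory Defs
  imports "HOL-Analysis.Analysis"
begin

text \<open>Derivatives are taken within \<open>S\<close>, hence are one-sided at an endpoint belonging to \<open>S\<close>
  (such as \<open>0\<close> for \<open>S = [0,R)\<close>). The library's \<open>C1_differentiable_on\<close> would also
  constrain the function outside \<open>S\<close> near such an endpoint.\<close>
definition C1_on :: "real set \<Rightarrow> (real \<Rightarrow> real) \<Rightarrow> bool" where
  "C1_on S f \<longleftrightarrow>
     (\<exists>f'. (\<forall>x\<in>S. (f has_real_derivative f' x) (at x within S)) \<and> continuous_on S f')"

definition L_infinity :: "(real \<Rightarrow> real) \<Rightarrow> bool" where
  "L_infinity f \<longleftrightarrow> f \<in> borel_measurable lborel \<and> (\<exists>C. AE x in lborel. \<bar>f x\<bar> \<le> C)"

text \<open>The interval integral is oriented, so it changes sign for \<open>\<rho> < 1\<close>.\<close>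
definition Q :: "(real \<Rightarrow> real) \<Rightarrow> real \<Rightarrow> real" where
  "Q \<kappa> \<rho> = (LBINT \<tau>=ereal 1..ereal \<rho>. (\<rho> - \<tau>) * \<kappa> \<tau>)"

text \<open>\<open>Q\<close> lives on \<open>[0,R)\<close>, so its derivative at \<open>0\<close> is the right derivative.\<close>
definition Q_deriv :: "real \<Rightarrow> (real \<Rightarrow> real) \<Rightarrow> real \<Rightarrow> real" where
  "Q_deriv R \<kappa> \<rho> = vector_derivative (Q \<kappa>) (at \<rho> within {0..<R})"

definition q :: "real \<Rightarrow> (real \<Rightarrow> real) \<Rightarrow> real \<Rightarrow> (int \<Rightarrow> real) \<Rightarrow> int \<Rightarrow> real" where
  "q R \<kappa> \<delta>x \<rho> i = (Q_deriv R \<kappa> (\<rho> (i + 1)) - Q_deriv R \<kappa> (\<rho> i)) / \<delta>x"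

definition G ::
  "real \<Rightarrow> (real \<Rightarrow> real) \<Rightarrow> (real \<Rightarrow> real) \<Rightarrow> real \<Rightarrow> (int \<Rightarrow> real) \<Rightarrow> int \<Rightarrow> real" where
  "G R \<kappa> h \<delta>x \<rho> i = \<rho> i * h (- q R \<kappa> \<delta>x \<rho> i)"

definition rho_plus ::
  "real \<Rightarrow> (real \<Rightarrow> real) \<Rightarrow> (real \<Rightarrow> real) \<Rightarrow> real \<Rightarrow> real \<Rightarrow> (int \<Rightarrow> real) \<Rightarrow> int \<Rightarrow> real" where
  "rho_plus R \<kappa> h \<delta>t \<delta>x \<rho> i =
     \<rho> i + \<delta>t / \<delta>x * (G R \<kappa> h \<delta>x \<rho> (i - 1) - G R \<kappa> h \<delta>x \<rho> i)"

end

theory Submission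
  imports Defs
begin

text \<open>The scheme is in conservative form, so mass can be created or lost only through the flux
  \<open>G\<close> at infinity. That flux is summable: \<open>h\<close> takes values in the bounded interval \<open>(-1, b)\<close>, whence
  \<open>\<bar>G i\<bar> \<le> max 1 b * \<rho> i\<close> (\<open>G_summable_on\<close>). The flux entering and the flux leaving the cells
  then have the same sum, because a sum over the integers is invariant under translation, and they
  cancel (\<open>has_sum_conservative_update\<close>). Splitting the series of flux differences in this way is
  legitimate since each of the two flux series converges on its own.\<close>

lemma has_sum_int_shift:
  fixes f :: "int \<Rightarrow> 'a :: {comm_monoid_add, topological_space}"
  assumes "(f has_sum s) UNIV"
  shows "((\<lambda>i. f (i - k)) has_sum s) UNIV"
proof -
  have "bij_betw (\<lambda>i. i - k) UNIV (UNIV :: int set)"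
    by (rule bij_betw_byWitness[where f' = "\<lambda>i. i + k"]) auto
  from has_sum_reindex_bij_betw[OF this, of f s] assms show ?thesis
    by simp
qed

lemma has_sum_conservative_update:
  fixes u g :: "int \<Rightarrow> real"
  assumes "(u has_sum s) UNIV" and "g summable_on UNIV"
  shows "((\<lambda>i. u i + c * (g (i - 1) - g i)) has_sum s) UNIV"
proof -
  from assms(2) obtain t where t: "(g has_sum t) UNIV"
    by (auto simp: summable_on_def)
  have "((\<lambda>i. g (i - 1) + - g i) has_sum t + - t) UNIV"
    by (intro has_sum_add has_sum_int_shift has_sum_uminusI t)
  then have "((\<lambda>i. c * (g (i - 1) - g i)) has_sum 0) UNIV"
    using has_sum_cmult_right[of _ UNIV 0 c] by simp
  from has_sum_add[OF assms(1) this] show ?thesis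
    by simp
qed

lemma G_summable_on:
  assumes "\<rho> summable_on UNIV" and "\<And>i. \<rho> i \<ge> 0" and "\<And>s. \<bar>h s\<bar> \<le> B"
  shows "G R \<kappa> h \<delta>x \<rho> summable_on UNIV"
proof (rule Infinite_Sum.abs_summable_summable, rule Infinite_Sum.abs_summable_on_comparison_test')
  show "(\<lambda>i. B * \<rho> i) summable_on UNIV"
    using assms(1) by (rule summable_on_cmult_right)
  show "norm (G R \<kappa> h \<delta>x \<rho> i) \<le> B * \<rho> i" for i
    using mult_left_mono[OF assms(3) assms(2)] assms(2)[of i]
    by (simp add: G_def abs_mult mult.commute)
qed

theorem proposition2:
  fixes R b \<delta>t \<delta>x :: real
    and \<kappa> h :: "real \<Rightarrow> real"
    and \<rho> :: "int \<Rightarrow> real"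
  assumes "R > 1" and "b > 0"
    and "C1_on {0..<R} \<kappa>"
    and "\<forall>r\<in>{0..<R}. \<kappa> r \<ge> 0"
    and "\<forall>r\<in>{0..1}. \<kappa> r = 0"
    and "\<forall>r\<in>{1<..<R}. \<kappa> r > 0"
    and "h C1_differentiable_on UNIV"
    and "L_infinity (deriv h)"
    and "h 0 = 0"
    and "\<forall>s. deriv h s > 0"
    and "range h = {-1<..<b}"
    and "\<delta>t > 0" and "\<delta>x > 0"
    and "\<forall>i. \<rho> i \<in> {0..<R}"
    and "\<rho> summable_on UNIV"
  shows "rho_plus R \<kappa> h \<delta>t \<delta>x \<rho> summable_on UNIV \<and>
    (\<Sum>\<^sub>\<infinity>i. rho_plus R \<kappa> h \<delta>t \<delta>x \<rho> i) = (\<Sum>\<^sub>\<infinity>i. \<rho> i)"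
proof -
  have "\<bar>h s\<bar> \<le> max 1 b" for s
  proof -
    have "h s \<in> {-1<..<b}"
      using \<open>range h = {-1<..<b}\<close> by blast
    then show ?thesis by auto
  qed
  then have "G R \<kappa> h \<delta>x \<rho> summable_on UNIV"
    using assms by (intro G_summable_on) auto
  moreover have "(\<rho> has_sum (\<Sum>\<^sub>\<infinity>i. \<rho> i)) UNIV"
    using \<open>\<rho> summable_on UNIV\<close> by (rule has_sum_infsum)
  ultimately have "(rho_plus R \<kappa> h \<delta>t \<delta>x \<rho> has_sum (\<Sum>\<^sub>\<infinity>i. \<rho> i)) UNIV"
    unfolding rho_plus_def[abs_def] by (intro has_sum_conservative_update)
  then show ?thesis
    by (auto simp: summable_on_def intro: infsumI)
qed

end
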